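(* Let $\mathcal{C}\le\mathbb{F}_{q^m}^n$ be a non-degenerate $[n,k]_{q^m/q}$ rank-metric code and let $c\in\mathcal{C}^\perp$. Then $V=\sigma(c)\le\mathbb{F}_q^n$ is a cyclic space of the $q$-matroid $M_{\mathcal{C}}$.
   Context: $q$ is a prime power, $m,n,k$ positive integers. An $[n,k]_{q^m/q}$ rank-metric code is a $k$-dimensional $\mathbb{F}_{q^m}$-linear subspace $\mathcal{C}$ of $\mathbb{F}_{q^m}^n$; it is non-degenerate if the columns of a generator matrix ($k\times n$ matrix whose rows form a basis of $\mathcal{C}$) are linearly independent over $\mathbb{F}_q$. $\mathcal{C}^\perp$ is the dual code with respect to the standard dot product $x\cdot y=\sum_j x_jy_j$ on $\mathbb{F}_{q^m}^n$. For $v\in\mathbb{F}_{q^m}^n$ and an $\mathbb{F}_q$-basis $\gamma_1,\dots,\gamma_m$ of $\mathbb{F}_{q^m}$, write $v_i=\sum_j\Gamma(v)_{ij}\gamma_j$ with $\Gamma(v)\in\mathbb{F}_q^{n\times m}$; the support $\sigma(v)\le\mathbb{F}_q^n$ is the column space of $\Gamma(v)$ (independent of the basis). For $U\le\mathbb{F}_q^n$ let $U^\perp$ be its orthogonal complement in $\mathbb{F}_q^n$ under the standard dot product and $\mathcal{C}(U)=\{v\in\mathcal{C}:\sigma(v)\le U^\perp\}$. The $q$-matroid $M_{\mathcal{C}}=(\mathbb{F}_q^n,r)$ has rank function $r(U)=k-\dim_{\mathbb{F}_{q^m}}\mathcal{C}(U)$. A subspace $A$ is cyclic if $r(B)=r(A)$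 for every subspace $B\le A$ of codimension $1$ in $A$. *)

theory Defs
  imports "HOL-Analysis.Cartesian_Space"
begin

text \<open>
  The extension of \<open>\<bbbF>\<^sub>q\<close> to \<open>\<bbbF>\<^bsub>q^m\<^esub>\<close> is given by two finite fields \<open>'a\<close>, \<open>'b\<close>
  and a unital ring homomorphism between them, which is automatically injective.
  The dimensions \<open>n\<close>, \<open>k\<close>, \<open>m\<close> are the cardinalities of the index types \<open>'n\<close>, \<open>'k\<close>, \<open>'m\<close>,
  and linear algebra in \<open>\<bbbF>\<^sub>q\<^sup>n\<close> and in \<open>\<bbbF>\<^bsub>q^m\<^esub>\<^sup>n\<close> is that of the interpretation \<open>vec\<close>
  (scalars \<open>'a\<close> and \<open>'b\<close>, respectively).
\<close>

locale field_embedding =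
  fixes emb :: "'a::{field,finite} \<Rightarrow> 'b::{field,finite}"
  assumes emb_one: "emb 1 = 1"
    and emb_add: "emb (x + y) = emb x + emb y"
    and emb_mult: "emb (x * y) = emb x * emb y"

definition ext_scale :: "('a \<Rightarrow> 'b) \<Rightarrow> 'a::{field,finite} \<Rightarrow> 'b::{field,finite} \<Rightarrow> 'b" where
  "ext_scale emb a x = emb a * x"

lemma (in field_embedding) vector_space_ext_scale: "vector_space (ext_scale emb)"
  by unfold_locales (simp_all add: ext_scale_def emb_one emb_add emb_mult algebra_simps)

definition is_ext_basis ::
    "('a::{field,finite} \<Rightarrow> 'b::{field,finite}) \<Rightarrow> ('m::finite \<Rightarrow> 'b) \<Rightarrow> bool" where
  "is_ext_basis emb \<gamma> \<longleftrightarrow>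
     inj \<gamma> \<and> \<not> module.dependent (ext_scale emb) (range \<gamma>) \<and>
     module.span (ext_scale emb) (range \<gamma>) = UNIV"

definition coeff_matrix ::
    "('a::{field,finite} \<Rightarrow> 'b::{field,finite}) \<Rightarrow> ('m::finite \<Rightarrow> 'b) \<Rightarrow> 'b^'n \<Rightarrow> 'a^'m^'n" where
  "coeff_matrix emb \<gamma> v =
     (\<chi> i j. module.representation (ext_scale emb) (range \<gamma>) (v $ i) (\<gamma> j))"

text \<open>The defining expansion \<open>v\<^sub>i = \<Sum>\<^sub>j \<Gamma>(v)\<^sub>i\<^sub>j \<gamma>\<^sub>j\<close>.\<close>

lemma (in field_embedding) coeff_matrix_expansion:
  fixes \<gamma> :: "'m::finite \<Rightarrow> 'b"
  assumes "is_ext_basis emb \<gamma>"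
  shows "v $ i = (\<Sum>j\<in>UNIV. emb (coeff_matrix emb \<gamma> v $ i $ j) * \<gamma> j)"
proof -
  interpret ext: vector_space "ext_scale emb"
    by (rule vector_space_ext_scale)
  have B: "inj \<gamma>" "ext.independent (range \<gamma>)" "v $ i \<in> ext.span (range \<gamma>)"
    using assms by (auto simp: is_ext_basis_def)
  have "v $ i = (\<Sum>b\<in>range \<gamma>. ext_scale emb (ext.representation (range \<gamma>) (v $ i) b) b)"
    using ext.sum_representation_eq[OF B(2,3), of "range \<gamma>"] by simp
  also have "\<dots> = (\<Sum>j\<in>UNIV. emb (coeff_matrix emb \<gamma> v $ i $ j) * \<gamma> j)"
    by (subst sum.reindex[OF B(1)]) (simp add: coeff_matrix_def ext_scale_def)
  finally show ?thesis .
qed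

definition rank_support ::
    "('a::{field,finite} \<Rightarrow> 'b::{field,finite}) \<Rightarrow> ('m::finite \<Rightarrow> 'b) \<Rightarrow> 'b^'n \<Rightarrow> ('a^'n) set" where
  "rank_support emb \<gamma> v = vec.span (columns (coeff_matrix emb \<gamma> v))"

definition dot :: "'f::field^'n \<Rightarrow> 'f^'n \<Rightarrow> 'f" where
  "dot x y = (\<Sum>j\<in>UNIV. x $ j * y $ j)"

text \<open>Used both for the dual code in \<open>\<bbbF>\<^bsub>q^m\<^esub>\<^sup>n\<close> and for orthogonal complements in \<open>\<bbbF>\<^sub>q\<^sup>n\<close>.\<close>

definition orth :: "('f::field^'n) set \<Rightarrow> ('f^'n) set" where
  "orth S = {y. \<forall>x\<in>S. dot x y = 0}"

definition is_code :: "nat \<Rightarrow> ('b::{field,finite}^'n) set \<Rightarrow> bool" where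
  "is_code k C \<longleftrightarrow> vec.subspace C \<and> vec.dim C = k"

definition is_generator_matrix :: "('b::{field,finite}^'n) set \<Rightarrow> 'b^'n^'k \<Rightarrow> bool" where
  "is_generator_matrix C G \<longleftrightarrow>
     inj (\<lambda>i. row i G) \<and> vec.independent (rows G) \<and> vec.span (rows G) = C"

text \<open>
  Linear independence over \<open>\<bbbF>\<^sub>q\<close> of the columns as a family, so that repeated columns count as
  dependent.  The argument of type \<open>'k itself\<close> fixes the number of rows of the generator matrix.
\<close>

definition nondegenerate ::
    "'k::finite itself \<Rightarrow> ('a::{field,finite} \<Rightarrow> 'b::{field,finite}) \<Rightarrow> ('b^'n) set \<Rightarrow> bool" where
  "nondegenerate K emb C \<longleftrightarrow>
     (\<exists>G :: 'b^'n^'k. is_generator_matrix C G \<and>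
        (\<forall>a :: 'n \<Rightarrow> 'a. (\<Sum>j\<in>UNIV. emb (a j) *s column j G) = 0 \<longrightarrow> (\<forall>j. a j = 0)))"

definition subcode ::
    "('a::{field,finite} \<Rightarrow> 'b::{field,finite}) \<Rightarrow> ('m::finite \<Rightarrow> 'b) \<Rightarrow> ('b^'n) set \<Rightarrow>
     ('a^'n) set \<Rightarrow> ('b^'n) set" where
  "subcode emb \<gamma> C U = {v \<in> C. rank_support emb \<gamma> v \<subseteq> orth U}"

definition code_rank ::
    "('a::{field,finite} \<Rightarrow> 'b::{field,finite}) \<Rightarrow> ('m::finite \<Rightarrow> 'b) \<Rightarrow> ('b^'n) set \<Rightarrow>
     ('a^'n) set \<Rightarrow> int" where
  "code_rank emb \<gamma> C U = int (vec.dim C) - int (vec.dim (subcode emb \<gamma> C U))"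

definition cyclic_space :: "(('a::{field,finite}^'n) set \<Rightarrow> int) \<Rightarrow> ('a^'n) set \<Rightarrow> bool" where
  "cyclic_space r A \<longleftrightarrow> vec.subspace A \<and>
     (\<forall>B. vec.subspace B \<and> B \<subseteq> A \<and> vec.dim A = vec.dim B + 1 \<longrightarrow> r B = r A)"

end

theory Submission imports Defs begin

text \<open>
  A codeword \<open>v\<close> lies in \<open>\<C>(U)\<close> iff the \<open>\<bbbF>\<^sub>q\<close>-linear map \<open>\<phi>(u) = v \<cdot> u\<close> vanishes on \<open>U\<close>.
  Let \<open>B\<close> be a hyperplane of \<open>V = \<sigma>(c)\<close>, let \<open>w \<in> V - B\<close>, and let \<open>\<phi>\<close> vanish on \<open>B\<close>.
  Writing the columns of \<open>\<Gamma>(c)\<close> as \<open>b\<^sub>j + a\<^sub>j w\<close> with \<open>b\<^sub>j \<in> B\<close>, the relation \<open>v \<cdot> c = 0\<close> becomes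
  \<open>(\<Sum>\<^sub>j a\<^sub>j \<gamma>\<^sub>j) \<phi>(w) = 0\<close>.  The first factor is nonzero, since otherwise all \<open>a\<^sub>j\<close> would vanish and
  \<open>V\<close> would be contained in \<open>B\<close>.  Hence \<open>\<phi>\<close> vanishes on \<open>V\<close>, so that \<open>\<C>(B) = \<C>(V)\<close>.
\<close>

lemma orth_antimono: "S \<subseteq> T \<Longrightarrow> orth T \<subseteq> orth S"
  by (auto simp: orth_def)

lemma dot_zero_right: "dot x 0 = 0"
  by (simp add: dot_def)

lemma dot_add_right: "dot x (y + z) = dot x y + dot x z"
  by (simp add: dot_def distrib_left sum.distrib)

lemma dot_scale_right: "dot x (a *s y) = a * dot x y"
  by (simp add: dot_def sum_distrib_left mult.left_commute)

lemma subspace_orth: "vec.subspace (orth S)"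
  by (rule vec.subspaceI) (simp_all add: orth_def dot_zero_right dot_add_right dot_scale_right)

context field_embedding
begin

lemma emb_zero [simp]: "emb 0 = 0"
proof -
  have "emb 0 + emb 0 = emb 0 + 0"
    using emb_add[of 0 0] by simp
  then show ?thesis
    by (rule add_left_imp_eq)
qed

lemma emb_sum: "emb (sum f A) = (\<Sum>x\<in>A. emb (f x))"
  by (induction A rule: infinite_finite_induct) (simp_all add: emb_add)

definition emb_vec :: "'a^'n \<Rightarrow> 'b^'n" where
  "emb_vec u = (\<chi> i. emb (u $ i))"

lemma dot_emb_vec_add: "dot v (emb_vec (x + y)) = dot v (emb_vec x) + dot v (emb_vec y)"
  by (simp add: dot_def emb_vec_def emb_add distrib_left sum.distrib)

lemma dot_emb_vec_scale: "dot v (emb_vec (a *s x)) = emb a * dot v (emb_vec x)"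
  by (simp add: dot_def emb_vec_def emb_mult sum_distrib_left mult.left_commute)

text \<open>Since \<open>\<gamma>\<close> is injective, independence of the set
  \<open>range \<gamma>\<close> passes to the indexed family; \<open>inv \<gamma>\<close> carries
  the coefficients over.\<close>

lemma ext_basis_combination_eq_0:
  fixes \<gamma> :: "'m::finite \<Rightarrow> 'b"
  assumes "is_ext_basis emb \<gamma>" and "(\<Sum>j\<in>UNIV. emb (a j) * \<gamma> j) = 0"
  shows "a j = 0"
proof -
  interpret ext: vector_space "ext_scale emb"
    by (rule vector_space_ext_scale)
  have inj: "inj \<gamma>" and ind: "ext.independent (range \<gamma>)"
    using assms(1) by (auto simp: is_ext_basis_def)
  have "(\<Sum>b\<in>range \<gamma>. ext_scale emb (a (inv \<gamma> b)) b) = 0"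
    using assms(2) by (simp add: sum.reindex[OF inj] inv_f_f[OF inj] ext_scale_def)
  then have "a (inv \<gamma> (\<gamma> j)) = 0"
    using ext.independentD[OF ind, of "range \<gamma>" "\<lambda>b. a (inv \<gamma> b)" "\<gamma> j"] by simp
  then show ?thesis
    by (simp add: inv_f_f[OF inj])
qed

text \<open>Expand each coordinate of \<open>c\<close> in the basis and swap the two sums. The
  coefficients of \<open>\<gamma> j\<close> lie in the large field here, so independence of the
  basis does not apply to them.\<close>

lemma dot_expansion:
  fixes \<gamma> :: "'m::finite \<Rightarrow> 'b"
  assumes "is_ext_basis emb \<gamma>"
  shows "dot v c = (\<Sum>j\<in>UNIV. dot v (emb_vec (column j (coeff_matrix emb \<gamma> c))) * \<gamma> j)"
proof -
  have "dot v c = (\<Sum>i\<in>UNIV. \<Sum>j\<in>UNIV. v $ i * (emb (coeff_matrix emb \<gamma> c $ i $ j) * \<gamma> j))"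
    by (simp add: dot_def coeff_matrix_expansion[OF assms, of c] sum_distrib_left)
  also have "\<dots> = (\<Sum>j\<in>UNIV. dot v (emb_vec (column j (coeff_matrix emb \<gamma> c))) * \<gamma> j)"
    by (subst sum.swap) (simp add: dot_def emb_vec_def column_def sum_distrib_right mult.assoc)
  finally show ?thesis .
qed

text \<open>By symmetry of \<open>dot\<close>, the word expanded is now \<open>v\<close>. The other
  factor has entries in the small field, so these coefficients are genuine basis
  coordinates.\<close>

lemma dot_emb_vec_expansion:
  fixes \<gamma> :: "'m::finite \<Rightarrow> 'b"
  assumes "is_ext_basis emb \<gamma>"
  shows "dot v (emb_vec u) = (\<Sum>j\<in>UNIV. emb (dot u (column j (coeff_matrix emb \<gamma> v))) * \<gamma> j)"
proof -
  have "dot v (emb_vec u) = dot (emb_vec u) v"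
    by (simp add: dot_def mult.commute)
  also have "\<dots> = (\<Sum>j\<in>UNIV. emb (dot u (column j (coeff_matrix emb \<gamma> v))) * \<gamma> j)"
    unfolding dot_expansion[OF assms, of "emb_vec u" v]
    by (simp add: dot_def emb_vec_def emb_sum emb_mult)
  finally show ?thesis .
qed

lemma rank_support_subset_orth_iff:
  fixes \<gamma> :: "'m::finite \<Rightarrow> 'b"
  assumes "is_ext_basis emb \<gamma>"
  shows "rank_support emb \<gamma> v \<subseteq> orth U \<longleftrightarrow> (\<forall>u\<in>U. dot v (emb_vec u) = 0)"
proof -
  \<comment> \<open>\<open>orth U\<close> is a subspace, so testing the generators of the support
    suffices.\<close>
  have "rank_support emb \<gamma> v \<subseteq> orth U \<longleftrightarrow> columns (coeff_matrix emb \<gamma> v) \<subseteq> orth U"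
    unfolding rank_support_def
    using vec.span_minimal[OF _ subspace_orth] vec.span_superset by blast
  also have "\<dots> \<longleftrightarrow> (\<forall>u\<in>U. \<forall>j. dot u (column j (coeff_matrix emb \<gamma> v)) = 0)"
    by (auto simp: columns_def orth_def)
  also have "\<dots> \<longleftrightarrow> (\<forall>u\<in>U. dot v (emb_vec u) = 0)"
  proof -
    have "(\<forall>j. dot u (column j (coeff_matrix emb \<gamma> v)) = 0) \<longleftrightarrow> dot v (emb_vec u) = 0" for u
      using ext_basis_combination_eq_0[OF assms, of "\<lambda>j. dot u (column j (coeff_matrix emb \<gamma> v))"]
      by (auto simp: dot_emb_vec_expansion[OF assms])
    then show ?thesis
      by simp
  qed
  finally show ?thesis .
qed

lemma dot_emb_vec_vanishes_on_support:
  fixes \<gamma> :: "'m::finite \<Rightarrow> 'b"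
  assumes \<gamma>: "is_ext_basis emb \<gamma>"
    and B: "vec.subspace B" "B \<subseteq> rank_support emb \<gamma> c"
      "vec.dim (rank_support emb \<gamma> c) = vec.dim B + 1"
    and vanish: "\<forall>u\<in>B. dot v (emb_vec u) = 0"
    and orthogonal: "dot v c = 0"
    and u: "u \<in> rank_support emb \<gamma> c"
  shows "dot v (emb_vec u) = 0"
proof -
  define V where "V = rank_support emb \<gamma> c"
  have V: "vec.subspace V"
    by (simp add: V_def rank_support_def)
  have "B \<noteq> V"
    using B(3) by (auto simp: V_def)
  then obtain w where w: "w \<in> V" "w \<notin> B"
    using B(2) by (auto simp: V_def)
  \<comment> \<open>Adjoining a vector outside \<open>B\<close> raises the dimension by one, which
    already reaches that of \<open>V\<close>.\<close>
  have "vec.span (insert w B) = V"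
  proof (rule vec.subspace_dim_equal)
    show "vec.span (insert w B) \<subseteq> V"
      using w(1) B(2) by (intro vec.span_minimal V) (auto simp: V_def)
    show "vec.dim V \<le> vec.dim (vec.span (insert w B))"
      using B(3) w(2) by (simp add: V_def vec.dim_insert vec.span_eq_iff[THEN iffD2, OF B(1)])
  qed (simp_all add: V)
  then have decomp: "\<exists>a. x - a *s w \<in> B" if "x \<in> V" for x
    using that vec.span_breakdown_eq[of x w B] vec.span_eq_iff[THEN iffD2, OF B(1)] by simp
  \<comment> \<open>The functional kills \<open>B\<close>, so on \<open>V\<close> it is determined
    by its value at \<open>w\<close>.\<close>
  have split: "dot v (emb_vec x) = emb a * dot v (emb_vec w)" if "x - a *s w \<in> B" for x a
    using vanish that dot_emb_vec_add[of v "x - a *s w" "a *s w"]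
    by (simp add: dot_emb_vec_scale)
  define col where "col j = column j (coeff_matrix emb \<gamma> c)" for j
  have columns: "columns (coeff_matrix emb \<gamma> c) = range col"
    by (auto simp: columns_def col_def)
  have "\<exists>a. col j - a *s w \<in> B" for j
    using decomp[of "col j"] vec.span_base[of "col j" "range col"]
    by (simp add: V_def rank_support_def columns)
  then obtain a where a: "col j - a j *s w \<in> B" for j
    by metis
  have "0 = (\<Sum>j\<in>UNIV. emb (a j) * dot v (emb_vec w) * \<gamma> j)"
    using orthogonal dot_expansion[OF \<gamma>, of v c] split[OF a] by (simp flip: col_def)
  also have "\<dots> = (\<Sum>j\<in>UNIV. emb (a j) * \<gamma> j) * dot v (emb_vec w)"
    unfolding sum_distrib_right by (simp only: mult_ac)
  finally have "(\<Sum>j\<in>UNIV. emb (a j) * \<gamma> j) = 0 \<or> dot v (emb_vec w) = 0"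
    by simp
  moreover have "(\<Sum>j\<in>UNIV. emb (a j) * \<gamma> j) \<noteq> 0"
  proof
    assume "(\<Sum>j\<in>UNIV. emb (a j) * \<gamma> j) = 0"
    then have "a j = 0" for j
      by (rule ext_basis_combination_eq_0[OF \<gamma>])
    then have "range col \<subseteq> B"
      using a by auto
    then have "V \<subseteq> B"
      unfolding V_def rank_support_def columns by (intro vec.span_minimal B(1))
    then show False
      using w by auto
  qed
  \<comment> \<open>The functional therefore vanishes at \<open>w\<close>, and \<open>split\<close>
    carries this over to \<open>u\<close>.\<close>
  ultimately show ?thesis
    using decomp[of u] split[of u] u by (auto simp: V_def)
qed

lemma subcode_hyperplane_eq:
  fixes \<gamma> :: "'m::finite \<Rightarrow> 'b"
  assumes "is_ext_basis emb \<gamma>" and "c \<in> orth C"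
    and "vec.subspace B" "B \<subseteq> rank_support emb \<gamma> c"
      "vec.dim (rank_support emb \<gamma> c) = vec.dim B + 1"
  shows "subcode emb \<gamma> C B = subcode emb \<gamma> C (rank_support emb \<gamma> c)"
proof
  show "subcode emb \<gamma> C (rank_support emb \<gamma> c) \<subseteq> subcode emb \<gamma> C B"
    using orth_antimono[OF assms(4)] by (auto simp: subcode_def)
  show "subcode emb \<gamma> C B \<subseteq> subcode emb \<gamma> C (rank_support emb \<gamma> c)"
    using dot_emb_vec_vanishes_on_support[OF assms(1,3-5)] assms(2)
    unfolding subcode_def rank_support_subset_orth_iff[OF assms(1)] by (auto simp: orth_def)
qed

end

theorem theorem4p12:
  fixes emb :: "'a::{field,finite} \<Rightarrow> 'b::{field,finite}"
    and \<gamma> :: "'m::finite \<Rightarrow> 'b"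
    and C :: "('b^'n) set"
    and c :: "'b^'n"
  assumes "field_embedding emb"
    and "is_ext_basis emb \<gamma>"
    and "is_code CARD('k::finite) C"
    and "nondegenerate TYPE('k) emb C"
    and "c \<in> orth C"
  shows "cyclic_space (code_rank emb \<gamma> C) (rank_support emb \<gamma> c)"
proof -
  interpret field_embedding emb
    by fact
  have "vec.subspace (rank_support emb \<gamma> c)"
    by (simp add: rank_support_def)
  \<comment> \<open>The subcodes of a hyperplane and of the whole support coincide as sets, so the
    ranks agree.\<close>
  then show ?thesis
    using subcode_hyperplane_eq[OF assms(2,5)] by (auto simp: cyclic_space_def code_rank_def)
qed

end
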